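(* Let $\mathcal H$ be a real Hilbert space, let $\mu\in\,]0,\infty[$, let $n\ge 1$ be an integer, $I=\{1,\dots,n\}$, and let $\lambda_i>0$ ($i\in I$) satisfy $\sum_{i\in I}\lambda_i=1$. Suppose that for each $i\in I$, $f_i:\mathcal H\to\,]-\infty,+\infty]$ is proper, lower semicontinuous and convex, and that there exists $i_0\in I$ such that $f_{i_0}$ is uniformly convex. Write $\mathbf f=(f_1,\dots,f_n)$, $\boldsymbol\lambda=(\lambda_1,\dots,\lambda_n)$. Then the proximal average $p_\mu(\mathbf f,\boldsymbol\lambda)$ is uniformly convex.
   Context: A proper function $f:\mathcal H\to\,]-\infty,+\infty]$ is uniformly convex if there exists a function $\phi:[0,\infty[\,\to[0,\infty]$ with $\phi(t)=0\Leftrightarrow t=0$ such that for all $x,y\in\mathcal H$ and every $\lambda\in\,]0,1[$, $$f\big((1-\lambda)x+\lambda y\big)+\lambda(1-\lambda)\phi(\|x-y\|)\le(1-\lambda)f(x)+\lambda f(y).$$ The $\boldsymbol\lambda$-weighted proximal average of $\mathbf f$ with parameter $\mu$ is the function $$p_\mu(\mathbf f,\boldsymbol\lambda)(x)=\frac1\mu\Big(-\frac12\|x\|^2+\inf_{\sum_{i\in I}x_i=x}\sum_{i\in I}\lambda_i\big(\mu f_i(x_i/\lambda_i)+\tfrac12\|x_i/\lambda_i\|^2\big)\Big),\quad x\in\mathcal H.$$ *)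

theory Defs
  imports "HOL-Analysis.Analysis"
begin

text \<open>
  Functions \<open>\<H> \<rightarrow> ]-\<infinity>,+\<infinity>]\<close> are modelled as \<^typ>\<open>ereal\<close>-valued functions; that the value
  \<open>-\<infinity>\<close> is not attained is part of properness.  Where that holds, the inequalities
  below never involve a sum of opposite infinities.
\<close>

definition proper_fun :: "('a \<Rightarrow> ereal) \<Rightarrow> bool" where
  "proper_fun f \<longleftrightarrow> (\<forall>x. f x \<noteq> -\<infinity>) \<and> (\<exists>x. f x \<noteq> \<infinity>)"

definition lsc_fun :: "('a::topological_space \<Rightarrow> ereal) \<Rightarrow> bool" where
  "lsc_fun f \<longleftrightarrow> (\<forall>x. f x \<le> Liminf (nhds x) f)"

definition convex_fun :: "('a::real_vector \<Rightarrow> ereal) \<Rightarrow> bool" where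
  "convex_fun f \<longleftrightarrow> (\<forall>x y. \<forall>t::real. 0 < t \<and> t < 1 \<longrightarrow>
     f ((1 - t) *\<^sub>R x + t *\<^sub>R y) \<le> ereal (1 - t) * f x + ereal t * f y)"

text \<open>Only the values of the modulus \<open>\<phi>\<close> on \<open>[0,\<infinity>[\<close> matter; it need not be monotone.\<close>

definition uniformly_convex_fun :: "('a::real_normed_vector \<Rightarrow> ereal) \<Rightarrow> bool" where
  "uniformly_convex_fun f \<longleftrightarrow> proper_fun f \<and>
     (\<exists>\<phi> :: real \<Rightarrow> ereal.
        (\<forall>t\<ge>0. 0 \<le> \<phi> t \<and> (\<phi> t = 0 \<longleftrightarrow> t = 0)) \<and>
        (\<forall>x y. \<forall>t::real. 0 < t \<and> t < 1 \<longrightarrow>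
           f ((1 - t) *\<^sub>R x + t *\<^sub>R y) + ereal (t * (1 - t)) * \<phi> (norm (x - y))
             \<le> ereal (1 - t) * f x + ereal t * f y))"

text \<open>
  The infimum ranges over families indexed by \<open>I\<close>, encoded as functions on the whole index
  type; their values outside \<open>I\<close> are irrelevant.
\<close>

definition proximal_average ::
    "real \<Rightarrow> 'i set \<Rightarrow> ('i \<Rightarrow> 'a::real_inner \<Rightarrow> ereal) \<Rightarrow> ('i \<Rightarrow> real) \<Rightarrow> 'a \<Rightarrow> ereal" where
  "proximal_average \<mu> I f l x =
     ereal (1 / \<mu>) *
       (ereal (- (1 / 2) * (norm x)\<^sup>2) +
        (INF u \<in> {u. (\<Sum>i\<in>I. u i) = x}.
           \<Sum>i\<in>I. ereal (l i) *
             (ereal \<mu> * f i (u i /\<^sub>R l i) + ereal (1 / 2 * (norm (u i /\<^sub>R l i))\<^sup>2))))"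

end

theory Submission
  imports Defs
begin

text \<open>
  Substituting \<open>u i = l i y i\<close>, the proximal average at \<open>x\<close> is the infimum, over all families \<open>y\<close>
  with barycentre \<open>\<Sum> l i y i = x\<close>, of
  \<open>\<Sum> l i (f i (y i)) + (1 / (2 \<mu>)) \<Sum> l i \<parallel>y i - x\<parallel>\<^sup>2\<close>:
  the negative square in the definition turns the squared norms into a variance, which is
  convex in \<open>y\<close> (\<open>barycentric_cost_eq\<close>).  Since \<open>f i + \<parallel>\<cdot>\<parallel>\<^sup>2 / (2 \<mu>)\<close> is bounded below
  (\<open>lsc_convex_quadratic_minorant\<close>), the infimum is not \<open>-\<infinity>\<close>, and the average is proper.

  Let \<open>f k\<close> be uniformly convex with modulus \<open>\<phi>\<close>, and let \<open>y0\<close>, \<open>y1\<close> be almost optimal for \<open>x0\<close>,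
  \<open>x1\<close>.  The family \<open>(1 - t) y0 + t y1\<close> is admissible for \<open>(1 - t) x0 + t x1\<close>, and its cost lies
  below the chord by \<open>t (1 - t)\<close> times at least
  \<open>l k \<phi>(\<parallel>d\<parallel>) + l k \<parallel>d - (x0 - x1)\<parallel>\<^sup>2 / (2 \<mu>)\<close>, where \<open>d = y0 k - y1 k\<close>
  (\<open>barycentric_cost_convex_combination\<close>).  Put \<open>s = \<parallel>x0 - x1\<parallel>\<close>.  If \<open>\<parallel>d\<parallel> < s / 2\<close>, the second
  term is at least \<open>l k (s / 2)\<^sup>2 / (2 \<mu>)\<close>.  If \<open>\<parallel>d\<parallel> \<ge> s / 2\<close>, the first may be replaced by
  \<open>l k \<phi>(s / 2)\<close>, because a modulus of a convex function can be used at any length up to the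
  distance of the points (\<open>uniformly_convex_fun_real_modulus\<close>).  So the minimum of these two
  bounds is a modulus for the average.
\<close>

section \<open>Real-valued forms of convexity inequalities\<close>

text \<open>
  Convexity inequalities are tested on the epigraph: only real upper bounds of the values at
  the end points matter, so that infinite values need no separate treatment later.
\<close>

lemma ereal_convexity_iff:
  fixes A B C :: ereal and t k :: real
  assumes t: "0 < t" "t < 1" and "A \<noteq> -\<infinity>" "B \<noteq> -\<infinity>"
  shows "C + ereal k \<le> ereal (1 - t) * A + ereal t * B \<longleftrightarrow>
    (\<forall>a b. A \<le> ereal a \<longrightarrow> B \<le> ereal b \<longrightarrow> C \<le> ereal ((1 - t) * a + t * b - k))"
    (is "?L \<longleftrightarrow> ?R")
proof
  assume L: ?L
  show ?R
  proof (intro allI impI)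
    fix a b assume ab: "A \<le> ereal a" "B \<le> ereal b"
    obtain ra rb where r: "A = ereal ra" "B = ereal rb"
      using ab assms(3,4) by (cases A; cases B) auto
    have "(1 - t) * ra + t * rb \<le> (1 - t) * a + t * b"
      using ab r t by (intro add_mono mult_left_mono) auto
    then show "C \<le> ereal ((1 - t) * a + t * b - k)"
      using L r by (cases C) auto
  qed
next
  assume R: ?R
  show ?L
  proof (cases "A = \<infinity> \<or> B = \<infinity>")
    case True
    then have "ereal (1 - t) * A + ereal t * B = \<infinity>"
      using t assms(3,4) by (cases A; cases B) auto
    then show ?thesis by (metis ereal_less_eq(1))
  next
    case False
    then obtain ra rb where r: "A = ereal ra" "B = ereal rb"
      using assms(3,4) by (cases A; cases B) auto
    then have "C \<le> ereal ((1 - t) * ra + t * rb - k)"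
      using R by simp
    then show ?thesis using r by (cases C) auto
  qed
qed

lemma convex_funD:
  assumes "convex_fun f" "proper_fun f" "0 \<le> t" "t \<le> 1" "f x \<le> ereal a" "f y \<le> ereal b"
  shows "f ((1 - t) *\<^sub>R x + t *\<^sub>R y) \<le> ereal ((1 - t) * a + t * b)"
proof (cases "t = 0 \<or> t = 1")
  case True
  then show ?thesis using assms by auto
next
  case False
  then have t: "0 < t" "t < 1" using assms by auto
  have "f ((1 - t) *\<^sub>R x + t *\<^sub>R y) + ereal 0 \<le> ereal (1 - t) * f x + ereal t * f y"
    using assms(1) t unfolding convex_fun_def by simp
  then show ?thesis
    using ereal_convexity_iff[OF t, of "f x" "f y" _ 0] assms unfolding proper_fun_def by auto
qed

text \<open>
  A modulus of uniform convexity may be used at every length not exceeding the distance of the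
  two points, although it is not assumed monotone.  With \<open>s = c \<parallel>x - y\<parallel>\<close>, \<open>c \<le> 1\<close>, the point
  \<open>x + t (y - x)\<close> divides the subsegment with parameters \<open>t (1 - c)\<close> and \<open>t (1 - c) + c\<close>, of
  length \<open>s\<close>, in the same ratio \<open>t : 1 - t\<close> as it divides the whole segment; so the modulus at
  \<open>s\<close> enters with the same factor \<open>t (1 - t)\<close>.  Truncation at 1 makes the modulus real-valued.
\<close>

lemma uniformly_convex_fun_real_modulus:
  fixes f :: "'a::real_normed_vector \<Rightarrow> ereal"
  assumes "uniformly_convex_fun f" and "convex_fun f"
  obtains \<phi> :: "real \<Rightarrow> real"
  where "\<And>s. 0 < s \<Longrightarrow> 0 < \<phi> s"
    and "\<phi> 0 = 0"
    and "\<And>s x y t a b. \<lbrakk>0 \<le> s; s \<le> norm (x - y); 0 < t; t < 1; f x \<le> ereal a; f y \<le> ereal b\<rbrakk>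
      \<Longrightarrow> f ((1 - t) *\<^sub>R x + t *\<^sub>R y) \<le> ereal ((1 - t) * a + t * b - t * (1 - t) * \<phi> s)"
proof -
  have pf: "proper_fun f" using assms unfolding uniformly_convex_fun_def by auto
  obtain \<Phi> :: "real \<Rightarrow> ereal"
    where \<Phi>: "\<And>t. 0 \<le> t \<Longrightarrow> 0 \<le> \<Phi> t \<and> (\<Phi> t = 0 \<longleftrightarrow> t = 0)"
      and uc: "\<And>x y t. 0 < t \<Longrightarrow> t < 1 \<Longrightarrow>
        f ((1 - t) *\<^sub>R x + t *\<^sub>R y) + ereal (t * (1 - t)) * \<Phi> (norm (x - y))
          \<le> ereal (1 - t) * f x + ereal t * f y"
    using assms(1) unfolding uniformly_convex_fun_def by blast
  define \<phi> where "\<phi> = (\<lambda>s. real_of_ereal (min (\<Phi> s) 1))"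
  have \<phi>: "ereal (\<phi> s) = min (\<Phi> s) 1" if "0 \<le> s" for s
  proof -
    have "0 \<le> \<Phi> s" using \<Phi> that by blast
    then show ?thesis unfolding \<phi>_def by (cases "\<Phi> s") (auto simp: min_def one_ereal_def)
  qed
  have exact: "f ((1 - t) *\<^sub>R x + t *\<^sub>R y) \<le> ereal ((1 - t) * a + t * b - t * (1 - t) * \<phi> (norm (x - y)))"
    if t: "0 < t" "t < 1" and ab: "f x \<le> ereal a" "f y \<le> ereal b" for x y t a b
  proof -
    have "ereal (t * (1 - t)) * ereal (\<phi> (norm (x - y))) \<le> ereal (t * (1 - t)) * \<Phi> (norm (x - y))"
      using t \<phi>[of "norm (x - y)"] by (intro ereal_mult_left_mono) auto
    then have "f ((1 - t) *\<^sub>R x + t *\<^sub>R y) + ereal (t * (1 - t) * \<phi> (norm (x - y)))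
        \<le> ereal (1 - t) * f x + ereal t * f y"
      using uc[OF t, of x y] by (metis add_left_mono order_trans times_ereal.simps(1))
    then show ?thesis
      using ereal_convexity_iff[OF t] pf ab unfolding proper_fun_def by blast
  qed
  show thesis
  proof (rule that[of \<phi>])
    show "0 < \<phi> s" if "0 < s" for s
    proof -
      have "0 < \<Phi> s" using \<Phi>[of s] that by (auto simp: less_le)
      then have "0 < ereal (\<phi> s)" using \<phi>[of s] that by simp
      then show ?thesis by simp
    qed
    have "ereal (\<phi> 0) = 0" using \<phi>[of 0] \<Phi>[of 0] by simp
    then show "\<phi> 0 = 0" by simp
    show "f ((1 - t) *\<^sub>R x + t *\<^sub>R y) \<le> ereal ((1 - t) * a + t * b - t * (1 - t) * \<phi> s)"
      if s: "0 \<le> s" "s \<le> norm (x - y)" and t: "0 < t" "t < 1"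
        and ab: "f x \<le> ereal a" "f y \<le> ereal b" for s x y t a b
    proof -
      define c where "c = (if s = 0 then 0 else s / norm (x - y))"
      have c: "0 \<le> c" "c \<le> 1" "c * norm (x - y) = s"
        using s unfolding c_def by (auto simp: divide_simps)
      define p where "p = t * (1 - c)"
      define q where "q = p + c"
      have q': "1 - q = (1 - t) * (1 - c)" unfolding q_def p_def by (simp add: algebra_simps)
      have p01: "0 \<le> p" "p \<le> 1"
        using t c unfolding p_def by (auto intro: mult_le_one)
      have q01: "0 \<le> q" "q \<le> 1"
      proof -
        show "0 \<le> q" using p01 c unfolding q_def by simp
        have "0 \<le> 1 - q" using q' t c by simp
        then show "q \<le> 1" by simp
      qed
      define xp where "xp = (1 - p) *\<^sub>R x + p *\<^sub>R y"
      define xq where "xq = (1 - q) *\<^sub>R x + q *\<^sub>R y"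
      have fp: "f xp \<le> ereal ((1 - p) * a + p * b)" and fq: "f xq \<le> ereal ((1 - q) * a + q * b)"
        unfolding xp_def xq_def using convex_funD[OF assms(2) pf] p01 q01 ab by blast+
      have "xp - xq = c *\<^sub>R (x - y)"
        unfolding xp_def xq_def q_def by (simp add: algebra_simps)
      then have n: "norm (xp - xq) = s" using c by simp
      have tt: "(1 - t) * p + t * q = t" unfolding q_def p_def by (simp add: algebra_simps)
      have "(1 - t) *\<^sub>R xp + t *\<^sub>R xq
          = ((1 - t) * (1 - p) + t * (1 - q)) *\<^sub>R x + ((1 - t) * p + t * q) *\<^sub>R y"
        unfolding xp_def xq_def by (simp add: scaleR_add_right scaleR_add_left)
      also have "(1 - t) * (1 - p) + t * (1 - q) = 1 - ((1 - t) * p + t * q)"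
        by (simp add: algebra_simps)
      finally have pt: "(1 - t) *\<^sub>R xp + t *\<^sub>R xq = (1 - t) *\<^sub>R x + t *\<^sub>R y"
        unfolding tt .
      have "(1 - t) * ((1 - p) * a + p * b) + t * ((1 - q) * a + q * b)
          = (1 - ((1 - t) * p + t * q)) * a + ((1 - t) * p + t * q) * b"
        by (simp add: algebra_simps)
      then have val: "(1 - t) * ((1 - p) * a + p * b) + t * ((1 - q) * a + q * b)
          = (1 - t) * a + t * b"
        unfolding tt .
      show ?thesis using exact[OF t fp fq] unfolding n pt val .
    qed
  qed
qed

section \<open>A quadratic minorant\<close>

text \<open>
  Lower semicontinuity bounds \<open>f\<close> below near a point \<open>z\<close> of its domain, and convexity along
  the rays issuing from \<open>z\<close> propagates this to a minorant that decreases only linearly in the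
  distance from \<open>z\<close>.
\<close>

lemma lsc_convex_linear_minorant:
  fixes f :: "'a::real_normed_vector \<Rightarrow> ereal"
  assumes "proper_fun f" "lsc_fun f" "convex_fun f"
  obtains \<alpha> \<beta> :: real where "0 \<le> \<beta>" and "\<And>x. ereal (\<alpha> - \<beta> * norm x) \<le> f x"
proof -
  obtain z where "f z \<noteq> \<infinity>" "f z \<noteq> -\<infinity>" using assms(1) unfolding proper_fun_def by auto
  then obtain r where r: "f z = ereal r" by (cases "f z") auto
  have "ereal (r - 1) < f z" using r by simp
  also have "f z \<le> Liminf (nhds z) f" using assms(2) unfolding lsc_fun_def by blast
  finally have "ereal (r - 1) < Liminf (nhds z) f" .
  then have "eventually (\<lambda>x. ereal (r - 1) < f x) (nhds z)"
    by (rule less_LiminfD)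
  then obtain d where d: "0 < d" "\<And>x. dist x z < d \<Longrightarrow> ereal (r - 1) < f x"
    unfolding eventually_nhds_metric by auto
  define e where "e = d / 2"
  have e: "0 < e" "e < d" using d unfolding e_def by auto
  have main: "ereal (r - 1 - norm (x - z) / e) \<le> f x" for x
  proof (cases "norm (x - z) \<le> e")
    case True
    then have "ereal (r - 1) < f x" using d(2)[of x] e by (simp add: dist_norm)
    moreover have "ereal (r - 1 - norm (x - z) / e) \<le> ereal (r - 1)" using e by simp
    ultimately show ?thesis by (meson less_imp_le order_trans)
  next
    case False
    define t where "t = e / norm (x - z)"
    have t: "0 < t" "t \<le> 1" "t * norm (x - z) = e" using False e unfolding t_def
      by (auto simp: divide_simps)
    show ?thesis
    proof (rule ccontr)
      assume "\<not> ?thesis"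
      then have fx: "f x \<le> ereal (r - 1 - norm (x - z) / e)" by simp
      have "f ((1 - t) *\<^sub>R z + t *\<^sub>R x) \<le> ereal ((1 - t) * r + t * (r - 1 - norm (x - z) / e))"
        using convex_funD[OF assms(3,1)] t r fx by simp
      also have "(1 - t) * r + t * (r - 1 - norm (x - z) / e) = r - t - t * norm (x - z) / e"
        by (simp add: algebra_simps)
      also have "\<dots> = r - t - 1" using t(3) e by simp
      finally have up: "f ((1 - t) *\<^sub>R z + t *\<^sub>R x) \<le> ereal (r - t - 1)" .
      have "(1 - t) *\<^sub>R z + t *\<^sub>R x - z = t *\<^sub>R (x - z)" by (simp add: algebra_simps)
      then have "dist ((1 - t) *\<^sub>R z + t *\<^sub>R x) z < d"
        using t e by (simp add: dist_norm)
      from less_le_trans[OF d(2)[OF this] up] show False using t by simp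
    qed
  qed
  show thesis
  proof (rule that[of "1 / e" "r - 1 - norm z / e"])
    show "0 \<le> 1 / e" using e by simp
    fix x
    have "norm (x - z) / e \<le> (norm x + norm z) / e"
      using e norm_triangle_ineq4[of x z] by (intro divide_right_mono) auto
    then have "ereal (r - 1 - norm z / e - 1 / e * norm x) \<le> ereal (r - 1 - norm (x - z) / e)"
      by (simp add: add_divide_distrib)
    then show "ereal (r - 1 - norm z / e - 1 / e * norm x) \<le> f x"
      using main[of x] by (rule order_trans)
  qed
qed

lemma lsc_convex_quadratic_minorant:
  fixes f :: "'a::real_normed_vector \<Rightarrow> ereal" and \<mu> :: real
  assumes "proper_fun f" "lsc_fun f" "convex_fun f" and \<mu>: "0 < \<mu>"
  shows "\<exists>C::real. \<forall>x. ereal (C - (norm x)\<^sup>2 / (2 * \<mu>)) \<le> f x"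
proof -
  obtain \<alpha> \<beta> :: real where ab: "0 \<le> \<beta>" "\<And>x. ereal (\<alpha> - \<beta> * norm x) \<le> f x"
    using lsc_convex_linear_minorant[OF assms(1-3)] by metis
  have "ereal (\<alpha> - \<mu> * \<beta>\<^sup>2 / 2 - (norm x)\<^sup>2 / (2 * \<mu>)) \<le> f x" for x
  proof -
    have "0 \<le> (norm x - \<mu> * \<beta>)\<^sup>2 / (2 * \<mu>)" using \<mu> by simp
    also have "\<dots> = (norm x)\<^sup>2 / (2 * \<mu>) - \<beta> * norm x + \<mu> * \<beta>\<^sup>2 / 2"
      using \<mu> by (simp add: field_simps power2_eq_square)
    finally have "ereal (\<alpha> - \<mu> * \<beta>\<^sup>2 / 2 - (norm x)\<^sup>2 / (2 * \<mu>)) \<le> ereal (\<alpha> - \<beta> * norm x)"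
      by simp
    then show ?thesis using ab(2)[of x] by (rule order_trans)
  qed
  then show ?thesis by blast
qed

section \<open>The proximal average as an infimum of real costs\<close>

text \<open>
  The cost of writing \<open>x\<close> as the barycentre of the points \<open>y i\<close> with weights \<open>l i\<close>, when \<open>v i\<close> is
  the value, or an upper bound of the value, of \<open>f i\<close> at \<open>y i\<close>.  The quadratic part is the
  variance of the points about \<open>x\<close>.
\<close>

definition barycentric_cost ::
    "real \<Rightarrow> 'i set \<Rightarrow> ('i \<Rightarrow> real) \<Rightarrow> 'a::real_inner \<Rightarrow> ('i \<Rightarrow> 'a) \<Rightarrow> ('i \<Rightarrow> real) \<Rightarrow> real" where
  "barycentric_cost \<mu> I l x y v =
     (\<Sum>i\<in>I. l i * v i) + (\<Sum>i\<in>I. l i * (norm (y i - x))\<^sup>2) / (2 * \<mu>)"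

lemma weighted_variance:
  fixes y :: "'i \<Rightarrow> 'a::real_inner"
  assumes "(\<Sum>i\<in>I. l i) = 1" and "(\<Sum>i\<in>I. l i *\<^sub>R y i) = x"
  shows "(\<Sum>i\<in>I. l i * (norm (y i - x))\<^sup>2) = (\<Sum>i\<in>I. l i * (norm (y i))\<^sup>2) - (norm x)\<^sup>2"
proof -
  have "(\<Sum>i\<in>I. l i * (norm (y i - x))\<^sup>2)
      = (\<Sum>i\<in>I. l i * (norm (y i))\<^sup>2 - 2 * ((l i *\<^sub>R y i) \<bullet> x) + l i * (norm x)\<^sup>2)"
    by (intro sum.cong refl)
      (simp add: power2_norm_eq_inner inner_diff_left inner_diff_right inner_commute algebra_simps)
  also have "\<dots> = (\<Sum>i\<in>I. l i * (norm (y i))\<^sup>2) - 2 * ((\<Sum>i\<in>I. l i *\<^sub>R y i) \<bullet> x)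
      + (\<Sum>i\<in>I. l i) * (norm x)\<^sup>2"
    by (simp add: sum.distrib sum_subtractf sum_distrib_left sum_distrib_right inner_sum_left)
  finally show ?thesis using assms by (simp add: power2_norm_eq_inner)
qed

lemma barycentric_cost_eq:
  assumes "\<mu> \<noteq> 0" "(\<Sum>i\<in>I. l i) = 1" "(\<Sum>i\<in>I. l i *\<^sub>R y i) = x"
  shows "\<mu> * barycentric_cost \<mu> I l x y v
    = - (1 / 2) * (norm x)\<^sup>2 + (\<Sum>i\<in>I. l i * (\<mu> * v i + 1 / 2 * (norm (y i))\<^sup>2))"
proof -
  have "(\<Sum>i\<in>I. l i * (\<mu> * v i + 1 / 2 * (norm (y i))\<^sup>2))
      = \<mu> * (\<Sum>i\<in>I. l i * v i) + (\<Sum>i\<in>I. l i * (norm (y i))\<^sup>2) / 2"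
    by (simp add: sum.distrib sum_distrib_left sum_divide_distrib algebra_simps)
  then show ?thesis
    unfolding barycentric_cost_def weighted_variance[OF assms(2,3)] using assms(1)
    by (simp add: field_simps)
qed

lemma proximal_average_le:
  fixes f :: "'i \<Rightarrow> 'a::real_inner \<Rightarrow> ereal"
  assumes \<mu>: "0 < \<mu>" and l: "\<And>i. i \<in> I \<Longrightarrow> 0 < l i" "(\<Sum>i\<in>I. l i) = 1"
    and y: "(\<Sum>i\<in>I. l i *\<^sub>R y i) = x" and v: "\<And>i. i \<in> I \<Longrightarrow> f i (y i) \<le> ereal (v i)"
  shows "proximal_average \<mu> I f l x \<le> ereal (barycentric_cost \<mu> I l x y v)"
proof -
  let ?S = "\<Sum>i\<in>I. l i * (\<mu> * v i + 1 / 2 * (norm (y i))\<^sup>2)"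
  let ?G = "\<lambda>u. \<Sum>i\<in>I. ereal (l i) *
             (ereal \<mu> * f i (u i /\<^sub>R l i) + ereal (1 / 2 * (norm (u i /\<^sub>R l i))\<^sup>2))"
  have "(INF u \<in> {u. (\<Sum>i\<in>I. u i) = x}. ?G u) \<le> ?G (\<lambda>i. l i *\<^sub>R y i)"
    using y by (intro INF_lower) simp
  also have "\<dots> \<le> (\<Sum>i\<in>I. ereal (l i * (\<mu> * v i + 1 / 2 * (norm (y i))\<^sup>2)))"
  proof (rule sum_mono)
    fix i assume i: "i \<in> I"
    have "ereal \<mu> * f i (y i) \<le> ereal \<mu> * ereal (v i)"
      using v[OF i] \<mu> by (intro ereal_mult_left_mono) auto
    then have "ereal \<mu> * f i (y i) + ereal (1 / 2 * (norm (y i))\<^sup>2)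
        \<le> ereal (\<mu> * v i + 1 / 2 * (norm (y i))\<^sup>2)"
      by (metis add_right_mono plus_ereal.simps(1) times_ereal.simps(1))
    then have "ereal (l i) * (ereal \<mu> * f i (y i) + ereal (1 / 2 * (norm (y i))\<^sup>2))
        \<le> ereal (l i) * ereal (\<mu> * v i + 1 / 2 * (norm (y i))\<^sup>2)"
      using l(1)[OF i] by (intro ereal_mult_left_mono) auto
    then show "ereal (l i) * (ereal \<mu> * f i ((l i *\<^sub>R y i) /\<^sub>R l i)
          + ereal (1 / 2 * (norm ((l i *\<^sub>R y i) /\<^sub>R l i))\<^sup>2))
        \<le> ereal (l i * (\<mu> * v i + 1 / 2 * (norm (y i))\<^sup>2))"
      using l(1)[OF i] by simp
  qed
  also have "\<dots> = ereal ?S" by simp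
  finally have "ereal (- (1 / 2) * (norm x)\<^sup>2) + (INF u \<in> {u. (\<Sum>i\<in>I. u i) = x}. ?G u)
      \<le> ereal (- (1 / 2) * (norm x)\<^sup>2) + ereal ?S"
    by (rule add_left_mono)
  then have "proximal_average \<mu> I f l x \<le> ereal (1 / \<mu>) * ereal (- (1 / 2) * (norm x)\<^sup>2 + ?S)"
    unfolding proximal_average_def using \<mu> by (intro ereal_mult_left_mono) auto
  also have "\<dots> = ereal (barycentric_cost \<mu> I l x y v)"
    using barycentric_cost_eq[OF _ l(2) y, of \<mu> v, symmetric] \<mu> by simp
  finally show ?thesis .
qed

lemma proximal_average_less:
  fixes f :: "'i \<Rightarrow> 'a::real_inner \<Rightarrow> ereal"
  assumes \<mu>: "0 < \<mu>" and I: "finite I"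
    and l: "\<And>i. i \<in> I \<Longrightarrow> 0 < l i" "(\<Sum>i\<in>I. l i) = 1"
    and f: "\<And>i. i \<in> I \<Longrightarrow> proper_fun (f i)"
    and less: "proximal_average \<mu> I f l x < ereal a"
  obtains y v where "(\<Sum>i\<in>I. l i *\<^sub>R y i) = x" "\<And>i. i \<in> I \<Longrightarrow> f i (y i) = ereal (v i)"
    "barycentric_cost \<mu> I l x y v < a"
proof -
  let ?G = "\<lambda>u. \<Sum>i\<in>I. ereal (l i) *
             (ereal \<mu> * f i (u i /\<^sub>R l i) + ereal (1 / 2 * (norm (u i /\<^sub>R l i))\<^sup>2))"
  let ?c = "- (1 / 2) * (norm x)\<^sup>2"
  have *: "ereal (1 / \<mu>) * (ereal ?c + (INF u \<in> {u. (\<Sum>i\<in>I. u i) = x}. ?G u)) < ereal a"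
    using less unfolding proximal_average_def .
  have "(INF u \<in> {u. (\<Sum>i\<in>I. u i) = x}. ?G u) < ereal (\<mu> * a - ?c)"
  proof (cases "INF u \<in> {u. (\<Sum>i\<in>I. u i) = x}. ?G u")
    case (real r)
    have "(?c + r) / \<mu> < a" using *[unfolded real] by simp
    then show ?thesis unfolding real using \<mu> by (simp add: field_simps)
  next
    case PInf
    show ?thesis using *[unfolded PInf] \<mu> by simp
  next
    case MInf
    then show ?thesis by simp
  qed
  then obtain u where u: "(\<Sum>i\<in>I. u i) = x" "?G u < ereal (\<mu> * a - ?c)"
    unfolding INF_less_iff by blast
  define y where "y = (\<lambda>i. u i /\<^sub>R l i)"
  define v where "v = (\<lambda>i. real_of_ereal (f i (y i)))"
  have v: "f i (y i) = ereal (v i)" if i: "i \<in> I" for i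
  proof -
    have "f i (y i) \<noteq> \<infinity>"
    proof
      assume "f i (y i) = \<infinity>"
      then have "ereal (l i) * (ereal \<mu> * f i (u i /\<^sub>R l i) + ereal (1 / 2 * (norm (u i /\<^sub>R l i))\<^sup>2)) = \<infinity>"
        using \<mu> l(1)[OF i] unfolding y_def by simp
      then have "?G u = \<infinity>" using I i unfolding sum_Pinfty by blast
      then show False using u(2) by simp
    qed
    then show ?thesis using f[OF i] unfolding v_def proper_fun_def by (cases "f i (y i)") auto
  qed
  have y: "(\<Sum>i\<in>I. l i *\<^sub>R y i) = x"
  proof -
    have "(\<Sum>i\<in>I. l i *\<^sub>R y i) = (\<Sum>i\<in>I. u i)"
      unfolding y_def by (intro sum.cong refl) (use l(1) in fastforce)
    then show ?thesis using u(1) by simp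
  qed
  have "?G u = (\<Sum>i\<in>I. ereal (l i * (\<mu> * v i + 1 / 2 * (norm (y i))\<^sup>2)))"
    using v by (intro sum.cong refl) (simp add: y_def)
  then have "(\<Sum>i\<in>I. l i * (\<mu> * v i + 1 / 2 * (norm (y i))\<^sup>2)) < \<mu> * a - ?c"
    using u(2) by simp
  then have "\<mu> * barycentric_cost \<mu> I l x y v < \<mu> * a"
    using barycentric_cost_eq[OF _ l(2) y, of \<mu> v] \<mu> by simp
  then have "barycentric_cost \<mu> I l x y v < a" using \<mu> by simp
  then show thesis using that[of y v] y v by blast
qed

lemma proper_proximal_average:
  fixes f :: "'i \<Rightarrow> 'a::real_inner \<Rightarrow> ereal"
  assumes \<mu>: "0 < \<mu>" and I: "finite I"
    and l: "\<And>i. i \<in> I \<Longrightarrow> 0 < l i" "(\<Sum>i\<in>I. l i) = 1"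
    and f: "\<And>i. i \<in> I \<Longrightarrow> proper_fun (f i)" "\<And>i. i \<in> I \<Longrightarrow> lsc_fun (f i)"
      "\<And>i. i \<in> I \<Longrightarrow> convex_fun (f i)"
  shows "proper_fun (proximal_average \<mu> I f l)"
  unfolding proper_fun_def
proof
  show "\<forall>x. proximal_average \<mu> I f l x \<noteq> -\<infinity>"
  proof (rule allI, rule notI)
    fix x assume inf: "proximal_average \<mu> I f l x = -\<infinity>"
    have "\<forall>i\<in>I. \<exists>C::real. \<forall>x. ereal (C - (norm x)\<^sup>2 / (2 * \<mu>)) \<le> f i x"
      using lsc_convex_quadratic_minorant[OF f \<mu>] by blast
    then obtain C :: "'i \<Rightarrow> real"
      where C: "\<And>i x. i \<in> I \<Longrightarrow> ereal (C i - (norm x)\<^sup>2 / (2 * \<mu>)) \<le> f i x"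
      by metis
    have "proximal_average \<mu> I f l x < ereal ((\<Sum>i\<in>I. l i * C i) - (norm x)\<^sup>2 / (2 * \<mu>))"
      using inf by simp
    then obtain y v where y: "(\<Sum>i\<in>I. l i *\<^sub>R y i) = x"
      and v: "\<And>i. i \<in> I \<Longrightarrow> f i (y i) = ereal (v i)"
      and less: "barycentric_cost \<mu> I l x y v < (\<Sum>i\<in>I. l i * C i) - (norm x)\<^sup>2 / (2 * \<mu>)"
      using proximal_average_less[where f = f, OF \<mu> I l f(1)] by blast
    have "(\<Sum>i\<in>I. l i * (C i - (norm (y i))\<^sup>2 / (2 * \<mu>))) \<le> (\<Sum>i\<in>I. l i * v i)"
    proof (intro sum_mono mult_left_mono)
      fix i assume i: "i \<in> I"
      show "C i - (norm (y i))\<^sup>2 / (2 * \<mu>) \<le> v i" using C[OF i, of "y i"] v[OF i] by simp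
      show "0 \<le> l i" using l(1)[OF i] by simp
    qed
    then have "(\<Sum>i\<in>I. l i * C i) \<le> (\<Sum>i\<in>I. l i * v i) + (\<Sum>i\<in>I. l i * (norm (y i))\<^sup>2) / (2 * \<mu>)"
      by (simp add: right_diff_distrib sum_subtractf sum_divide_distrib)
    then show False
      using less unfolding barycentric_cost_def weighted_variance[OF l(2) y]
      by (simp add: diff_divide_distrib)
  qed
  have "\<forall>i\<in>I. \<exists>z r. f i z \<le> ereal r"
  proof
    fix i assume "i \<in> I"
    then obtain z where "f i z \<noteq> \<infinity>" using f(1) unfolding proper_fun_def by blast
    then have "f i z \<le> ereal (real_of_ereal (f i z))" by (cases "f i z") auto
    then show "\<exists>z r. f i z \<le> ereal r" by blast
  qed
  then obtain z r where "\<And>i. i \<in> I \<Longrightarrow> f i (z i) \<le> ereal (r i)" by metis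
  then have "proximal_average \<mu> I f l (\<Sum>i\<in>I. l i *\<^sub>R z i)
      \<le> ereal (barycentric_cost \<mu> I l (\<Sum>i\<in>I. l i *\<^sub>R z i) z r)"
    using proximal_average_le[OF \<mu> l refl] by blast
  then show "\<exists>x. proximal_average \<mu> I f l x \<noteq> \<infinity>" by (auto intro!: exI[of _ "\<Sum>i\<in>I. l i *\<^sub>R z i"])
qed

section \<open>Uniform convexity\<close>

lemma norm_convex_combination_sq:
  fixes a b :: "'a::real_inner"
  shows "(norm ((1 - t) *\<^sub>R a + t *\<^sub>R b))\<^sup>2
    = (1 - t) * (norm a)\<^sup>2 + t * (norm b)\<^sup>2 - t * (1 - t) * (norm (a - b))\<^sup>2"
  unfolding power2_norm_eq_inner
  by (simp add: inner_diff_left inner_diff_right inner_add_left inner_add_right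
      inner_commute[of b a] algebra_simps)

text \<open>
  Suppose that at the index \<open>k\<close> the value at the convex combination lies below the chord by
  \<open>t (1 - t) g\<close>.  Then the cost lies below its chord by this gain, weighted by \<open>l k\<close>, plus a
  contribution of the variance, of which only the summand at \<open>k\<close> is kept: the squared
  deviation of the displacement \<open>y0 k - y1 k\<close> from \<open>x0 - x1\<close>.
\<close>

lemma barycentric_cost_convex_combination:
  fixes x0 x1 :: "'a::real_inner"
  assumes \<mu>: "0 < \<mu>" and I: "finite I" "k \<in> I" and l: "\<And>i. i \<in> I \<Longrightarrow> 0 < l i"
    and t: "0 < t" "t < 1"
  shows "barycentric_cost \<mu> I l ((1 - t) *\<^sub>R x0 + t *\<^sub>R x1) (\<lambda>i. (1 - t) *\<^sub>R y0 i + t *\<^sub>R y1 i)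
      (\<lambda>i. (1 - t) * v0 i + t * v1 i - (if i = k then t * (1 - t) * g else 0))
    \<le> (1 - t) * barycentric_cost \<mu> I l x0 y0 v0 + t * barycentric_cost \<mu> I l x1 y1 v1
      - t * (1 - t) * (l k * g + l k * (norm (y0 k - y1 k - (x0 - x1)))\<^sup>2 / (2 * \<mu>))"
proof -
  let ?D = "\<lambda>i. (norm (y0 i - y1 i - (x0 - x1)))\<^sup>2"
  let ?Q = "\<lambda>x y. \<Sum>i\<in>I. l i * (norm (y i - x))\<^sup>2"
  let ?x = "(1 - t) *\<^sub>R x0 + t *\<^sub>R x1" and ?y = "\<lambda>i. (1 - t) *\<^sub>R y0 i + t *\<^sub>R y1 i"
  have lin: "(\<Sum>i\<in>I. l i * ((1 - t) * v0 i + t * v1 i - (if i = k then t * (1 - t) * g else 0)))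
      = (1 - t) * (\<Sum>i\<in>I. l i * v0 i) + t * (\<Sum>i\<in>I. l i * v1 i) - t * (1 - t) * (l k * g)"
  proof -
    have "(\<Sum>i\<in>I. l i * ((1 - t) * v0 i + t * v1 i - (if i = k then t * (1 - t) * g else 0)))
        = (\<Sum>i\<in>I. (1 - t) * (l i * v0 i) + t * (l i * v1 i)
            - (if i = k then t * (1 - t) * (l k * g) else 0))"
      by (intro sum.cong refl) (auto simp: algebra_simps)
    then show ?thesis using I by (simp add: sum.distrib sum_subtractf sum_distrib_left)
  qed
  have "?y i - ?x = (1 - t) *\<^sub>R (y0 i - x0) + t *\<^sub>R (y1 i - x1)" for i
    by (simp add: algebra_simps)
  then have n: "(norm (?y i - ?x))\<^sup>2
      = (1 - t) * (norm (y0 i - x0))\<^sup>2 + t * (norm (y1 i - x1))\<^sup>2 - t * (1 - t) * ?D i" for i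
    using norm_convex_combination_sq[of t "y0 i - x0" "y1 i - x1"]
    by (simp add: algebra_simps)
  have "?Q ?x ?y = (\<Sum>i\<in>I. (1 - t) * (l i * (norm (y0 i - x0))\<^sup>2)
      + t * (l i * (norm (y1 i - x1))\<^sup>2) - t * (1 - t) * (l i * ?D i))"
    by (intro sum.cong refl, subst n) (simp add: algebra_simps)
  also have "\<dots> = (1 - t) * ?Q x0 y0 + t * ?Q x1 y1 - t * (1 - t) * (\<Sum>i\<in>I. l i * ?D i)"
    by (simp add: sum.distrib sum_subtractf sum_distrib_left)
  also have "\<dots> \<le> (1 - t) * ?Q x0 y0 + t * ?Q x1 y1 - t * (1 - t) * (l k * ?D k)"
  proof -
    have "l k * ?D k \<le> (\<Sum>i\<in>I. l i * ?D i)"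
      using I l by (intro member_le_sum) (auto simp: less_imp_le)
    then show ?thesis using t by (simp add: mult_left_mono)
  qed
  finally have "?Q ?x ?y / (2 * \<mu>)
      \<le> ((1 - t) * ?Q x0 y0 + t * ?Q x1 y1 - t * (1 - t) * (l k * ?D k)) / (2 * \<mu>)"
    using \<mu> by (intro divide_right_mono) auto
  also have "\<dots> = (1 - t) * (?Q x0 y0 / (2 * \<mu>)) + t * (?Q x1 y1 / (2 * \<mu>))
      - t * (1 - t) * (l k * ?D k / (2 * \<mu>))"
    by (simp add: add_divide_distrib diff_divide_distrib)
  finally show ?thesis
    unfolding barycentric_cost_def lin by (simp only: distrib_left)
qed

theorem theorem3p14:
  fixes f :: "nat \<Rightarrow> 'a::{real_inner, complete_space} \<Rightarrow> ereal"
    and l :: "nat \<Rightarrow> real" and \<mu> :: real and n :: nat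
  assumes "0 < \<mu>" and "1 \<le> n"
    and "\<And>i. i \<in> {1..n} \<Longrightarrow> 0 < l i"
    and "(\<Sum>i\<in>{1..n}. l i) = 1"
    and "\<And>i. i \<in> {1..n} \<Longrightarrow> proper_fun (f i)"
    and "\<And>i. i \<in> {1..n} \<Longrightarrow> lsc_fun (f i)"
    and "\<And>i. i \<in> {1..n} \<Longrightarrow> convex_fun (f i)"
    and "\<exists>i0\<in>{1..n}. uniformly_convex_fun (f i0)"
  shows "uniformly_convex_fun (proximal_average \<mu> {1..n} f l)"
proof -
  let ?I = "{1..n}" and ?p = "proximal_average \<mu> {1..n} f l"
  note \<mu> = assms(1) and l = assms(3,4) and f = assms(5,6,7)
  have pf: "proper_fun ?p"
    by (rule proper_proximal_average[where f = f, OF \<mu> finite_atLeastAtMost l f])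
  obtain k where k: "k \<in> ?I" "uniformly_convex_fun (f k)" using assms(8) by blast
  obtain \<phi> :: "real \<Rightarrow> real" where \<phi>: "\<And>s. 0 < s \<Longrightarrow> 0 < \<phi> s" "\<phi> 0 = 0"
    and uc: "\<And>s x y t a b. \<lbrakk>0 \<le> s; s \<le> norm (x - y); 0 < t; t < 1; f k x \<le> ereal a; f k y \<le> ereal b\<rbrakk>
      \<Longrightarrow> f k ((1 - t) *\<^sub>R x + t *\<^sub>R y) \<le> ereal ((1 - t) * a + t * b - t * (1 - t) * \<phi> s)"
    using uniformly_convex_fun_real_modulus[OF k(2) f(3)[OF k(1)]] by metis
  have lk: "0 < l k" using l(1) k(1) .
  define \<psi> where "\<psi> = (\<lambda>s. min (l k * \<phi> (s / 2)) (l k * (s / 2)\<^sup>2 / (2 * \<mu>)))"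
  have \<psi>: "0 \<le> ereal (\<psi> s) \<and> (ereal (\<psi> s) = 0 \<longleftrightarrow> s = 0)" if "0 \<le> s" for s
  proof (cases "s = 0")
    case True
    then show ?thesis using \<phi>(2) unfolding \<psi>_def by simp
  next
    case False
    then have "0 < \<psi> s" using that \<phi>(1)[of "s / 2"] lk \<mu> unfolding \<psi>_def by simp
    then show ?thesis using False by simp
  qed
  have le: "?p ((1 - t) *\<^sub>R x0 + t *\<^sub>R x1) \<le> ereal ((1 - t) * a + t * b - t * (1 - t) * \<psi> (norm (x0 - x1)))"
    if t: "0 < t" "t < 1" and ab: "?p x0 \<le> ereal a" "?p x1 \<le> ereal b" for x0 x1 t a b
  proof (rule ereal_le_epsilon2)
    fix e :: real assume e: "0 < e"
    let ?s = "norm (x0 - x1)"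
    have less: "?p x0 < ereal (a + e)" "?p x1 < ereal (b + e)"
      using ab e by (auto intro: le_less_trans[of _ "ereal a"] le_less_trans[of _ "ereal b"])
    obtain y0 v0 where y0: "(\<Sum>i\<in>?I. l i *\<^sub>R y0 i) = x0"
      and v0: "\<And>i. i \<in> ?I \<Longrightarrow> f i (y0 i) = ereal (v0 i)"
      and c0: "barycentric_cost \<mu> ?I l x0 y0 v0 < a + e"
      using proximal_average_less[where f = f, OF \<mu> finite_atLeastAtMost l f(1) less(1)] by blast
    obtain y1 v1 where y1: "(\<Sum>i\<in>?I. l i *\<^sub>R y1 i) = x1"
      and v1: "\<And>i. i \<in> ?I \<Longrightarrow> f i (y1 i) = ereal (v1 i)"
      and c1: "barycentric_cost \<mu> ?I l x1 y1 v1 < b + e"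
      using proximal_average_less[where f = f, OF \<mu> finite_atLeastAtMost l f(1) less(2)] by blast
    define y where "y = (\<lambda>i. (1 - t) *\<^sub>R y0 i + t *\<^sub>R y1 i)"
    \<comment> \<open>The gain at index \<open>k\<close> is worth counting only if the displacement there is not much
      shorter than \<open>x0 - x1\<close>; otherwise the variance term supplies the modulus.\<close>
    define g where "g = (if ?s / 2 \<le> norm (y0 k - y1 k) then \<phi> (?s / 2) else 0)"
    define v where "v = (\<lambda>i. (1 - t) * v0 i + t * v1 i - (if i = k then t * (1 - t) * g else 0))"
    define R where "R = l k * g + l k * (norm (y0 k - y1 k - (x0 - x1)))\<^sup>2 / (2 * \<mu>)"
    have y: "(\<Sum>i\<in>?I. l i *\<^sub>R y i) = (1 - t) *\<^sub>R x0 + t *\<^sub>R x1"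
      unfolding y_def y0[symmetric] y1[symmetric]
      by (simp add: scaleR_add_right sum.distrib scaleR_sum_right mult.commute)
    have v: "f i (y i) \<le> ereal (v i)" if i: "i \<in> ?I" for i
    proof -
      have "f i (y i) \<le> ereal ((1 - t) * v0 i + t * v1 i)"
        unfolding y_def using convex_funD[OF f(3,1)] i t v0 v1 by simp
      moreover have "f i (y i) \<le> ereal (v i)" if "i = k" "?s / 2 \<le> norm (y0 k - y1 k)"
        using uc[of "?s / 2" "y0 k" "y1 k" t "v0 k" "v1 k"] that t v0 v1 k(1)
        unfolding y_def v_def g_def by simp
      ultimately show ?thesis unfolding v_def g_def by (auto split: if_splits)
    qed
    have "\<psi> ?s \<le> R"
    proof (cases "?s / 2 \<le> norm (y0 k - y1 k)")
      case True
      have "0 \<le> l k * (norm (y0 k - y1 k - (x0 - x1)))\<^sup>2 / (2 * \<mu>)" using lk \<mu> by simp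
      then show ?thesis using True unfolding R_def g_def \<psi>_def by simp
    next
      case False
      have "?s - norm (y0 k - y1 k) \<le> norm (y0 k - y1 k - (x0 - x1))"
        using norm_triangle_ineq2[of "x0 - x1" "y0 k - y1 k"]
        by (simp add: norm_minus_commute)
      then have "?s / 2 \<le> norm (y0 k - y1 k - (x0 - x1))" using False by linarith
      then have "(?s / 2)\<^sup>2 \<le> (norm (y0 k - y1 k - (x0 - x1)))\<^sup>2"
        by (intro power_mono) auto
      then have "l k * (?s / 2)\<^sup>2 / (2 * \<mu>) \<le> l k * (norm (y0 k - y1 k - (x0 - x1)))\<^sup>2 / (2 * \<mu>)"
        using lk \<mu> by (intro divide_right_mono mult_left_mono) auto
      then show ?thesis using False unfolding R_def g_def \<psi>_def by simp
    qed
    then have gain: "t * (1 - t) * \<psi> ?s \<le> t * (1 - t) * R" using t by simp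
    have "barycentric_cost \<mu> ?I l ((1 - t) *\<^sub>R x0 + t *\<^sub>R x1) y v
        \<le> (1 - t) * barycentric_cost \<mu> ?I l x0 y0 v0 + t * barycentric_cost \<mu> ?I l x1 y1 v1
          - t * (1 - t) * R"
      unfolding y_def v_def R_def
      by (rule barycentric_cost_convex_combination[where l = l, OF \<mu> finite_atLeastAtMost k(1) l(1) t])
    also have "\<dots> \<le> (1 - t) * (a + e) + t * (b + e) - t * (1 - t) * \<psi> ?s"
      using c0 c1 t gain by (intro diff_mono add_mono mult_left_mono) auto
    also have "\<dots> = (1 - t) * a + t * b - t * (1 - t) * \<psi> ?s + e" by (simp add: algebra_simps)
    finally have "ereal (barycentric_cost \<mu> ?I l ((1 - t) *\<^sub>R x0 + t *\<^sub>R x1) y v)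
        \<le> ereal ((1 - t) * a + t * b - t * (1 - t) * \<psi> ?s) + ereal e" by simp
    moreover have "?p ((1 - t) *\<^sub>R x0 + t *\<^sub>R x1)
        \<le> ereal (barycentric_cost \<mu> ?I l ((1 - t) *\<^sub>R x0 + t *\<^sub>R x1) y v)"
      by (rule proximal_average_le[where f = f and l = l and v = v, OF \<mu> l y v])
    ultimately show "?p ((1 - t) *\<^sub>R x0 + t *\<^sub>R x1)
        \<le> ereal ((1 - t) * a + t * b - t * (1 - t) * \<psi> ?s) + ereal e"
      by (rule order_trans[rotated])
  qed
  have mod: "?p ((1 - t) *\<^sub>R x0 + t *\<^sub>R x1) + ereal (t * (1 - t)) * ereal (\<psi> (norm (x0 - x1)))
      \<le> ereal (1 - t) * ?p x0 + ereal t * ?p x1" if t: "0 < t" "t < 1" for x0 x1 t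
  proof -
    have "?p x0 \<noteq> -\<infinity>" "?p x1 \<noteq> -\<infinity>" using pf unfolding proper_fun_def by blast+
    note iff = ereal_convexity_iff[OF t this, where C = "?p ((1 - t) *\<^sub>R x0 + t *\<^sub>R x1)"
        and k = "t * (1 - t) * \<psi> (norm (x0 - x1))"]
    show ?thesis
      unfolding times_ereal.simps iff using le t by blast
  qed
  show ?thesis
    unfolding uniformly_convex_fun_def
  proof (intro conjI exI[of _ "\<lambda>s. ereal (\<psi> s)"] allI impI)
    show "proper_fun ?p" by (rule pf)
  next
    fix s :: real assume "0 \<le> s"
    then show "0 \<le> ereal (\<psi> s)" "ereal (\<psi> s) = 0 \<longleftrightarrow> s = 0" using \<psi> by blast+
  next
    fix x0 x1 and t :: real assume "0 < t \<and> t < 1"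
    then show "?p ((1 - t) *\<^sub>R x0 + t *\<^sub>R x1) + ereal (t * (1 - t)) * ereal (\<psi> (norm (x0 - x1)))
      \<le> ereal (1 - t) * ?p x0 + ereal t * ?p x1" using mod by blast
  qed
qed

end
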